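(* For all bouquets $\Psi,\Phi$: $\Psi\vdash_{\mathsf N}\Phi$ if and only if $\vdash_{\mathsf N}(\Psi\rhd\Phi)$.
   Context: Fix a countable set $\mathcal{V}$ of variables and a first-order signature consisting of a countable set $\mathcal{P}$ of predicate symbols with an arity function $\mathrm{ar}:\mathcal{P}\to\mathbb{N}$. Flowers and gardens are defined by mutual induction: (1) if $p\in\mathcal{P}$ and $\vec{x}\in\mathcal{V}^{\mathrm{ar}(p)}$, then the atom $p(\vec{x})$ is a flower; (2) if $\mathbf{x}\subset\mathcal{V}$ is a finite set (a sprinkler; its elements are binders) and $\Phi$ is a finite multiset of flowers (a bouquet), then $\mathbf{x}\cdot\Phi$ is a garden; (3) if $\gamma$ is a garden (the pistil) and $\Delta$ is a finite multiset of gardens (a corolla, whose elements are petals), then $\gamma\rhd\Delta$ is a flower, also written $\gamma\rhd\delta_1;\dots;\delta_n$. A garden $\emptyset\cdot\Phi$ is written simply $\Phi$; the empty bouquet is $\emptyset$; a comma denotes multiset union of bouquets; $\mathbf{x},\mathbf{y}$ denotes $\mathbf{x}\cup\mathbf{y}$. For bouquets $\Psi,\Phi$, $(\Psi\rhd\Phi)$ denotes the flower with pistil $\emptyset\cdot\Psi$ and single petal $\emptyset\cdot\Phi$. Free variables: $\mathrm{fv}(p(\vec x))$ = variables of $\vec x$; $\mathrm{fv}(\Phi)=\bigcup_{\phi\in\Phi}\mathrm{fv}(\phi)$; $\mathrm{fv}(\mathbf{x}\cdot\Phi)=\mathrm{fv}(\Phi)\setminus\mathbf{x}$; $\mathrm{fv}(\mathbf{x}\cdot\Phi\rhd\Delta)=\mathrm{fv}(\mathbf{x}\cdot\Phi)\cup\bigcup_{\mathbf{y}\cdot\Psi\in\Delta}\mathrm{fv}((\mathbf{x}\cup\mathbf{y})\cdot\Psi)$.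 Bound variables: $\mathrm{bv}(p(\vec x))=\emptyset$; $\mathrm{bv}(\Phi)=\bigcup\mathrm{bv}(\phi)$; $\mathrm{bv}(\mathbf{x}\cdot\Phi)=\mathbf{x}\cup\mathrm{bv}(\Phi)$; $\mathrm{bv}(\gamma\rhd\Delta)=\mathrm{bv}(\gamma)\cup\bigcup_{\delta\in\Delta}\mathrm{bv}(\delta)$. Standing convention: every bouquet considered has pairwise distinct binders and $\mathrm{bv}(\Phi)\cap\mathrm{fv}(\Phi)=\emptyset$. Substitutions: $f[R\mapsto g]$ equals $g$ on $R$ and $f$ elsewhere. A substitution is $\sigma:\mathcal V\to\mathcal V$ with finite support; $\sigma:\mathbf y$ means support $\mathbf y$; $\sigma_{-\mathbf x}:=\sigma[\mathbf x\mapsto\mathrm{id}]$. Action: $\sigma(p(x_1,\dots,x_n))=p(\sigma(x_1),\dots,\sigma(x_n))$, elementwise on bouquets, $\sigma(\mathbf x\cdot\Phi)=\mathbf x\cdot\sigma_{-\mathbf x}(\Phi)$, $\sigma(\mathbf x\cdot\Phi\rhd\delta_1;\dots;\delta_n)=\sigma(\mathbf x\cdot\Phi)\rhd\sigma_{-\mathbf x}(\delta_1);\dots;\sigma_{-\mathbf x}(\delta_n)$. $\sigma:\mathbf y$ is capture-avoiding in $\Phi$ if $\sigma(\mathbf y)\cap\mathrm{bv}(\Phi)=\emptyset$. Contexts: $\Xi::=\Psi,\xi$, $\xi::=\Box\mid(\mathbf x\cdot\Xi\rhd\Delta)\mid(\gamma\rhd\mathbf x\cdot\Xi;\Delta)$.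 $\Xi\{\Psi\}$ replaces the hole by bouquet $\Psi$, $\Xi\{\}$ by $\emptyset$, $\Xi\{\Xi'\}$ by a context. A flower $\phi$ can be pollinated in $\Xi$ if there are a bouquet $\Psi\ni\phi$ and contexts $\Xi',\Xi_0$ with either $\Xi=\Xi'\{\Psi,\Xi_0\}$ or $\Xi=\Xi'\{\mathbf x\cdot\Psi\rhd\mathbf y\cdot\Xi_0;\Delta\}$ for some $\mathbf x,\mathbf y,\Delta$; a bouquet can be pollinated in $\Xi$ if each of its flowers can. Natural rules $\mathsf N$ (steps conclusion $\to$ premiss): (poll↓) $\Xi\{\Phi\}\to\Xi\{\}$ and (poll↑) $\Xi\{\}\to\Xi\{\Phi\}$ whenever $\Phi$ can be pollinated in $\Xi$; (epis) $\Phi\to(\emptyset\cdot\emptyset\rhd\emptyset\cdot\Phi)$; (epet) $(\gamma\rhd\emptyset\cdot\emptyset;\Delta)\to\emptyset$; (srep) $(\mathbf x\cdot(\Phi,(\emptyset\cdot\emptyset\rhd\gamma_1;\dots;\gamma_n))\rhd\Delta)\to(\mathbf x\cdot\Phi\rhd\emptyset\cdot\{(\gamma_1\rhd\Delta),\dots,(\gamma_n\rhd\Delta)\})$; (ipis) $(\mathbf x,\mathbf y\cdot\Phi\rhd\Delta)\to(\mathbf x\cdot\sigma(\Phi)\rhd\sigma(\Delta)),(\mathbf x,\mathbf y\cdot\Phi\rhd\Delta)$ with $\sigma:\mathbf y$ capture-avoiding in $(\emptyset\cdot\Phi\rhd\Delta)$; (ipet) $(\gamma\rhd\mathbf x,\mathbf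 y\cdot\Phi;\Delta)\to(\gamma\rhd\mathbf x\cdot\sigma(\Phi);\mathbf x,\mathbf y\cdot\Phi;\Delta)$ with $\sigma:\mathbf y$ capture-avoiding in $\Phi$. Natural steps are closed under arbitrary contexts: if $\Phi\to\Psi$ is an instance of an $\mathsf N$-rule then $\Xi\{\Phi\}\to_{\mathsf N}\Xi\{\Psi\}$ for every context $\Xi$. $\Phi\to^*_{\mathsf N}\Psi$ means a finite (possibly empty) sequence of natural steps. Hypothetical provability: $\Psi\vdash_{\mathsf N}\Phi$ means $\Xi\{\Phi\}\to^*_{\mathsf N}\Xi\{\}$ for every context $\Xi$ in which $\Psi$ can be pollinated; $\vdash_{\mathsf N}\Phi$ means $\emptyset\vdash_{\mathsf N}\Phi$. *)

theory Defs
  imports Main "HOL-Library.Multiset" "HOL-Library.FSet" "HOL-Library.Countable"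
begin

section \<open>Flowers and gardens\<close>

datatype ('p, 'v) flower =
    Atom 'p "'v list"
  | Flower "('p, 'v) garden" "('p, 'v) garden multiset"
and ('p, 'v) garden =
    Garden (sprinkler: "'v fset") (contents: "('p, 'v) flower multiset")

type_synonym ('p, 'v) bouquet = "('p, 'v) flower multiset"
type_synonym ('p, 'v) corolla = "('p, 'v) garden multiset"

definition imp :: "('p, 'v) bouquet \<Rightarrow> ('p, 'v) bouquet \<Rightarrow> ('p, 'v) flower" where
  "imp \<Psi> \<Phi> = Flower (Garden {||} \<Psi>) {#Garden {||} \<Phi>#}"

primrec arity_flower :: "('p \<Rightarrow> nat) \<Rightarrow> ('p, 'v) flower \<Rightarrow> bool"
  and arity_garden :: "('p \<Rightarrow> nat) \<Rightarrow> ('p, 'v) garden \<Rightarrow> bool" where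
  "arity_flower ar (Atom p xs) \<longleftrightarrow> length xs = ar p"
| "arity_flower ar (Flower \<gamma> \<Delta>) \<longleftrightarrow>
     arity_garden ar \<gamma> \<and> (\<forall>b \<in># image_mset (arity_garden ar) \<Delta>. b)"
| "arity_garden ar (Garden x \<Phi>) \<longleftrightarrow> (\<forall>b \<in># image_mset (arity_flower ar) \<Phi>. b)"

definition arity_bouquet :: "('p \<Rightarrow> nat) \<Rightarrow> ('p, 'v) bouquet \<Rightarrow> bool" where
  "arity_bouquet ar \<Phi> \<longleftrightarrow> (\<forall>\<phi> \<in># \<Phi>. arity_flower ar \<phi>)"


section \<open>Free and bound variables\<close>

text \<open>The binders of a pistil also scope over all petals of its flower.\<close>

primrec fv_flower :: "('p, 'v) flower \<Rightarrow> 'v set"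
  and fv_garden :: "('p, 'v) garden \<Rightarrow> 'v set" where
  "fv_flower (Atom p xs) = set xs"
| "fv_flower (Flower \<gamma> \<Delta>) =
     fv_garden \<gamma> \<union> (\<Union> (set_mset (image_mset fv_garden \<Delta>)) - fset (sprinkler \<gamma>))"
| "fv_garden (Garden x \<Phi>) = \<Union> (set_mset (image_mset fv_flower \<Phi>)) - fset x"

definition fv :: "('p, 'v) bouquet \<Rightarrow> 'v set" where
  "fv \<Phi> = (\<Union>\<phi> \<in> set_mset \<Phi>. fv_flower \<phi>)"

lemma fv_garden_eq: "fv_garden (Garden x \<Phi>) = fv \<Phi> - fset x"
  by (simp add: fv_def)

lemma fv_flower_eq:
  fixes \<Phi> :: "('p, 'v) bouquet"
  shows "fv_flower (Flower (Garden x \<Phi>) \<Delta>) = fv_garden (Garden x \<Phi>) \<union>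
     (\<Union>\<delta> \<in> set_mset \<Delta>. fv_garden (Garden (x |\<union>| sprinkler \<delta>) (contents \<delta>)))"
proof -
  have "fv_garden \<delta> - fset x = fv_garden (Garden (x |\<union>| sprinkler \<delta>) (contents \<delta>))"
    for \<delta> :: "('p, 'v) garden"
    by (cases \<delta>) auto
  then show ?thesis
    by (auto simp del: fv_garden.simps)
qed

primrec bv_flower :: "('p, 'v) flower \<Rightarrow> 'v set"
  and bv_garden :: "('p, 'v) garden \<Rightarrow> 'v set" where
  "bv_flower (Atom p xs) = {}"
| "bv_flower (Flower \<gamma> \<Delta>) = bv_garden \<gamma> \<union> \<Union> (set_mset (image_mset bv_garden \<Delta>))"
| "bv_garden (Garden x \<Phi>) = fset x \<union> \<Union> (set_mset (image_mset bv_flower \<Phi>))"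

definition bv :: "('p, 'v) bouquet \<Rightarrow> 'v set" where
  "bv \<Phi> = (\<Union>\<phi> \<in> set_mset \<Phi>. bv_flower \<phi>)"

text \<open>Binders counted with multiplicity over all sprinklers, to express that they are
  pairwise distinct.\<close>

primrec binders_flower :: "('p, 'v) flower \<Rightarrow> 'v multiset"
  and binders_garden :: "('p, 'v) garden \<Rightarrow> 'v multiset" where
  "binders_flower (Atom p xs) = {#}"
| "binders_flower (Flower \<gamma> \<Delta>) = binders_garden \<gamma> + \<Sum>\<^sub># (image_mset binders_garden \<Delta>)"
| "binders_garden (Garden x \<Phi>) = mset_set (fset x) + \<Sum>\<^sub># (image_mset binders_flower \<Phi>)"

definition binders :: "('p, 'v) bouquet \<Rightarrow> 'v multiset" where
  "binders \<Phi> = \<Sum>\<^sub># (image_mset binders_flower \<Phi>)"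

text \<open>Arity-correct bouquets obeying the variable convention.\<close>

definition legal :: "('p \<Rightarrow> nat) \<Rightarrow> ('p, 'v) bouquet \<Rightarrow> bool" where
  "legal ar \<Phi> \<longleftrightarrow> arity_bouquet ar \<Phi> \<and> (\<forall>x. count (binders \<Phi>) x \<le> 1) \<and> bv \<Phi> \<inter> fv \<Phi> = {}"


section \<open>Substitutions\<close>

primrec subst_flower :: "('p, 'v) flower \<Rightarrow> ('v \<Rightarrow> 'v) \<Rightarrow> ('p, 'v) flower"
  and subst_garden :: "('p, 'v) garden \<Rightarrow> ('v \<Rightarrow> 'v) \<Rightarrow> ('p, 'v) garden" where
  "subst_flower (Atom p xs) \<sigma> = Atom p (map \<sigma> xs)"
| "subst_flower (Flower \<gamma> \<Delta>) \<sigma> = Flower (subst_garden \<gamma> \<sigma>)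
     (image_mset (\<lambda>\<delta>. subst_garden \<delta> (override_on \<sigma> id (fset (sprinkler \<gamma>)))) \<Delta>)"
| "subst_garden (Garden x \<Phi>) \<sigma> =
     Garden x (image_mset (\<lambda>\<phi>. subst_flower \<phi> (override_on \<sigma> id (fset x))) \<Phi>)"

definition subst :: "('v \<Rightarrow> 'v) \<Rightarrow> ('p, 'v) bouquet \<Rightarrow> ('p, 'v) bouquet" where
  "subst \<sigma> \<Phi> = image_mset (\<lambda>\<phi>. subst_flower \<phi> \<sigma>) \<Phi>"

definition subst_corolla :: "('v \<Rightarrow> 'v) \<Rightarrow> ('p, 'v) corolla \<Rightarrow> ('p, 'v) corolla" where
  "subst_corolla \<sigma> \<Delta> = image_mset (\<lambda>\<delta>. subst_garden \<delta> \<sigma>) \<Delta>"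

definition has_support :: "('v \<Rightarrow> 'v) \<Rightarrow> 'v fset \<Rightarrow> bool" where
  "has_support \<sigma> y \<longleftrightarrow> {v. \<sigma> v \<noteq> v} = fset y"

definition capture_avoiding :: "('v \<Rightarrow> 'v) \<Rightarrow> 'v fset \<Rightarrow> ('p, 'v) bouquet \<Rightarrow> bool" where
  "capture_avoiding \<sigma> y \<Phi> \<longleftrightarrow> \<sigma> ` fset y \<inter> bv \<Phi> = {}"


section \<open>Contexts\<close>

datatype ('p, 'v) ctx =
    Ctx "('p, 'v) bouquet" "('p, 'v) fctx"
and ('p, 'v) fctx =
    Hole
  | InPistil "'v fset" "('p, 'v) ctx" "('p, 'v) corolla"
  | InPetal "('p, 'v) garden" "'v fset" "('p, 'v) ctx" "('p, 'v) corolla"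

primrec fill :: "('p, 'v) ctx \<Rightarrow> ('p, 'v) bouquet \<Rightarrow> ('p, 'v) bouquet"
  and fill_fctx :: "('p, 'v) fctx \<Rightarrow> ('p, 'v) bouquet \<Rightarrow> ('p, 'v) bouquet" where
  "fill (Ctx \<Psi> \<xi>) \<Theta> = \<Psi> + fill_fctx \<xi> \<Theta>"
| "fill_fctx Hole \<Theta> = \<Theta>"
| "fill_fctx (InPistil x \<Xi> \<Delta>) \<Theta> = {#Flower (Garden x (fill \<Xi> \<Theta>)) \<Delta>#}"
| "fill_fctx (InPetal \<gamma> x \<Xi> \<Delta>) \<Theta> = {#Flower \<gamma> (add_mset (Garden x (fill \<Xi> \<Theta>)) \<Delta>)#}"

primrec ctx_add :: "('p, 'v) bouquet \<Rightarrow> ('p, 'v) ctx \<Rightarrow> ('p, 'v) ctx" where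
  "ctx_add \<Psi> (Ctx \<Psi>' \<xi>) = Ctx (\<Psi> + \<Psi>') \<xi>"

primrec ctx_comp :: "('p, 'v) ctx \<Rightarrow> ('p, 'v) ctx \<Rightarrow> ('p, 'v) ctx"
  and fctx_comp :: "('p, 'v) fctx \<Rightarrow> ('p, 'v) ctx \<Rightarrow> ('p, 'v) ctx" where
  "ctx_comp (Ctx \<Psi> \<xi>) \<Xi>' = ctx_add \<Psi> (fctx_comp \<xi> \<Xi>')"
| "fctx_comp Hole \<Xi>' = \<Xi>'"
| "fctx_comp (InPistil x \<Xi> \<Delta>) \<Xi>' = Ctx {#} (InPistil x (ctx_comp \<Xi> \<Xi>') \<Delta>)"
| "fctx_comp (InPetal \<gamma> x \<Xi> \<Delta>) \<Xi>' = Ctx {#} (InPetal \<gamma> x (ctx_comp \<Xi> \<Xi>') \<Delta>)"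

lemma fill_ctx_add: "fill (ctx_add \<Psi> \<Xi>) \<Theta> = \<Psi> + fill \<Xi> \<Theta>"
  by (cases \<Xi>) simp

lemma fill_ctx_comp:
  "fill (ctx_comp \<Xi> \<Xi>') \<Theta> = fill \<Xi> (fill \<Xi>' \<Theta>)"
  "fill (fctx_comp \<xi> \<Xi>') \<Theta> = fill_fctx \<xi> (fill \<Xi>' \<Theta>)"
  by (induction \<Xi> and \<xi>) (simp_all add: fill_ctx_add)


section \<open>Renaming of binders\<close>

text \<open>Several rules duplicate subterms, and hence binders, so the variable convention can only
  be maintained if bouquets are identified up to renaming of binders. One renaming step replaces
  a single binder, of a pistil or of a petal, by a variable not occurring in its scope.\<close>

inductive rename_step :: "('p, 'v) bouquet \<Rightarrow> ('p, 'v) bouquet \<Rightarrow> bool" where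
  pistil: "\<lbrakk> u |\<in>| x; w \<notin> fv_flower (Flower (Garden x \<Phi>) \<Delta>) \<union> bv_flower (Flower (Garden x \<Phi>) \<Delta>) \<rbrakk> \<Longrightarrow>
    rename_step
      (fill \<Xi> {#Flower (Garden x \<Phi>) \<Delta>#})
      (fill \<Xi> {#Flower (Garden (finsert w (x |-| {|u|})) (subst (id(u := w)) \<Phi>))
                   (subst_corolla (id(u := w)) \<Delta>)#})"
| petal: "\<lbrakk> u |\<in>| x; w \<notin> fv_garden (Garden x \<Phi>) \<union> bv_garden (Garden x \<Phi>) \<rbrakk> \<Longrightarrow>
    rename_step
      (fill \<Xi> {#Flower \<gamma> (add_mset (Garden x \<Phi>) \<Delta>)#})
      (fill \<Xi> {#Flower \<gamma> (add_mset (Garden (finsert w (x |-| {|u|})) (subst (id(u := w)) \<Phi>)) \<Delta>)#})"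

definition alpha :: "('p, 'v) bouquet \<Rightarrow> ('p, 'v) bouquet \<Rightarrow> bool" where
  "alpha = equivclp rename_step"


section \<open>Pollination, natural rules and provability\<close>

definition flower_pollinable :: "('p, 'v) flower \<Rightarrow> ('p, 'v) ctx \<Rightarrow> bool" where
  "flower_pollinable \<phi> \<Xi> \<longleftrightarrow>
     (\<exists>\<Psi> \<Xi>' \<Xi>\<^sub>0. (\<exists>\<phi>' \<in># \<Psi>. alpha {#\<phi>#} {#\<phi>'#}) \<and>
        (\<Xi> = ctx_comp \<Xi>' (ctx_add \<Psi> \<Xi>\<^sub>0) \<or>
         (\<exists>x y \<Delta>. \<Xi> = ctx_comp \<Xi>' (Ctx {#} (InPetal (Garden x \<Psi>) y \<Xi>\<^sub>0 \<Delta>)))))"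

definition pollinable :: "('p, 'v) bouquet \<Rightarrow> ('p, 'v) ctx \<Rightarrow> bool" where
  "pollinable \<Phi> \<Xi> \<longleftrightarrow> (\<forall>\<phi> \<in># \<Phi>. flower_pollinable \<phi> \<Xi>)"

inductive nat_rule :: "('p, 'v) bouquet \<Rightarrow> ('p, 'v) bouquet \<Rightarrow> bool" where
  poll_down: "pollinable \<Phi> \<Xi> \<Longrightarrow> nat_rule (fill \<Xi> \<Phi>) (fill \<Xi> {#})"
| poll_up: "pollinable \<Phi> \<Xi> \<Longrightarrow> nat_rule (fill \<Xi> {#}) (fill \<Xi> \<Phi>)"
| epis: "nat_rule \<Phi> {#Flower (Garden {||} {#}) {#Garden {||} \<Phi>#}#}"
| epet: "nat_rule {#Flower \<gamma> (add_mset (Garden {||} {#}) \<Delta>)#} {#}"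
| srep: "nat_rule
    {#Flower (Garden x (add_mset (Flower (Garden {||} {#}) \<Gamma>) \<Phi>)) \<Delta>#}
    {#Flower (Garden x \<Phi>) {#Garden {||} (image_mset (\<lambda>\<gamma>. Flower \<gamma> \<Delta>) \<Gamma>)#}#}"
| ipis: "\<lbrakk> has_support \<sigma> y; capture_avoiding \<sigma> y {#Flower (Garden {||} \<Phi>) \<Delta>#} \<rbrakk> \<Longrightarrow> nat_rule
    {#Flower (Garden (x |\<union>| y) \<Phi>) \<Delta>#}
    {#Flower (Garden x (subst \<sigma> \<Phi>)) (subst_corolla \<sigma> \<Delta>), Flower (Garden (x |\<union>| y) \<Phi>) \<Delta>#}"
| ipet: "\<lbrakk> has_support \<sigma> y; capture_avoiding \<sigma> y \<Phi> \<rbrakk> \<Longrightarrow> nat_rule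
    {#Flower \<gamma> (add_mset (Garden (x |\<union>| y) \<Phi>) \<Delta>)#}
    {#Flower \<gamma> (add_mset (Garden x (subst \<sigma> \<Phi>)) (add_mset (Garden (x |\<union>| y) \<Phi>) \<Delta>))#}"

text \<open>The rule is applied to a representative obeying the variable convention. The
  representative \<open>B\<close> of the result is again chosen to obey it: \<open>fill \<Xi> \<Psi>\<close> itself may contain
  duplicated binders.\<close>

definition nat_step :: "('p \<Rightarrow> nat) \<Rightarrow> ('p, 'v) bouquet \<Rightarrow> ('p, 'v) bouquet \<Rightarrow> bool" where
  "nat_step ar A B \<longleftrightarrow> legal ar A \<and> legal ar B \<and>
     (\<exists>\<Xi> \<Phi> \<Psi>. nat_rule \<Phi> \<Psi> \<and> legal ar (fill \<Xi> \<Phi>) \<and> alpha A (fill \<Xi> \<Phi>) \<and> alpha (fill \<Xi> \<Psi>) B)"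

text \<open>The bouquet \<open>\<Phi>\<close> stands for its class modulo renaming: a given context is filled with those
  representatives for which the result obeys the variable convention.\<close>

definition hyp_provable :: "('p \<Rightarrow> nat) \<Rightarrow> ('p, 'v) bouquet \<Rightarrow> ('p, 'v) bouquet \<Rightarrow> bool" where
  "hyp_provable ar \<Psi> \<Phi> \<longleftrightarrow>
     (\<forall>\<Xi> \<Phi>'. pollinable \<Psi> \<Xi> \<and> alpha \<Phi> \<Phi>' \<and> legal ar (fill \<Xi> \<Phi>') \<longrightarrow>
        (nat_step ar)\<^sup>*\<^sup>* (fill \<Xi> \<Phi>') (fill \<Xi> {#}))"

definition provable :: "('p \<Rightarrow> nat) \<Rightarrow> ('p, 'v) bouquet \<Rightarrow> bool" where
  "provable ar \<Phi> \<longleftrightarrow> hyp_provable ar {#} \<Phi>"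

end

theory Submission
  imports Defs
begin

text \<open>
  If \<open>\<Psi>\<close> proves \<open>\<Phi>\<close>, then \<open>\<Phi>\<close> can be erased in the petal of \<open>\<Psi> \<rhd> \<Phi>\<close>, where its pistil pollinates,
  and the resulting empty petal erases the whole flower. Conversely, in a context that \<open>\<Psi>\<close> can
  pollinate, \<open>\<Phi>\<close> is turned into \<open>\<emptyset> \<rhd> \<Phi>\<close> by epis and then into \<open>\<Psi> \<rhd> \<Phi>\<close> by pollination, which the
  hypothesis erases. For the latter the binders of \<open>\<Psi>\<close> must first be made fresh. The free variables
  of \<open>\<Psi>\<close> cause no conflict: pollinability means that a variant of each flower of \<open>\<Psi>\<close> occurs already
  at a place whose enclosing binders also enclose the hole, so filling \<open>\<Psi>\<close> in adds no free variable
  to the whole bouquet.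
\<close>

section \<open>Free variables, binders and arities\<close>

lemma fv_simps [simp]:
  "fv {#} = {}"
  "fv (add_mset \<phi> \<Phi>) = fv_flower \<phi> \<union> fv \<Phi>"
  "fv (\<Phi> + \<Psi>) = fv \<Phi> \<union> fv \<Psi>"
  by (auto simp: fv_def)

lemma binders_simps [simp]:
  "binders {#} = {#}"
  "binders (add_mset \<phi> \<Phi>) = binders_flower \<phi> + binders \<Phi>"
  "binders (\<Phi> + \<Psi>) = binders \<Phi> + binders \<Psi>"
  by (auto simp: binders_def)

lemma arity_bouquet_simps [simp]:
  "arity_bouquet ar {#}"
  "arity_bouquet ar (add_mset \<phi> \<Phi>) \<longleftrightarrow> arity_flower ar \<phi> \<and> arity_bouquet ar \<Phi>"
  "arity_bouquet ar (\<Phi> + \<Psi>) \<longleftrightarrow> arity_bouquet ar \<Phi> \<and> arity_bouquet ar \<Psi>"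
  by (auto simp: arity_bouquet_def)

text \<open>Restates the recursive equations through the bouquet-level functions. These replace the
  original equations as simp rules, so that unions and sums over flowers stay folded.\<close>

lemma Garden_simps [simp]:
  "fv_garden (Garden x \<Phi>) = fv \<Phi> - fset x"
  "bv_garden (Garden x \<Phi>) = fset x \<union> bv \<Phi>"
  "binders_garden (Garden x \<Phi>) = mset_set (fset x) + binders \<Phi>"
  "arity_garden ar (Garden x \<Phi>) \<longleftrightarrow> arity_bouquet ar \<Phi>"
  by (auto simp: fv_def bv_def binders_def arity_bouquet_def)

declare fv_garden.simps [simp del] bv_garden.simps [simp del] binders_garden.simps [simp del]
  arity_garden.simps [simp del]

text \<open>The bridge from counted binders to bound variables: identities between multisets of
  binders then yield the facts about \<open>bv\<close>, including finiteness.\<close>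

lemma
  fixes \<phi> :: "('p, 'v) flower" and \<gamma> :: "('p, 'v) garden"
  shows set_mset_binders_flower: "set_mset (binders_flower \<phi>) = bv_flower \<phi>"
  and set_mset_binders_garden: "set_mset (binders_garden \<gamma>) = bv_garden \<gamma>"
  by (induction \<phi> and \<gamma>) (auto simp: bv_def binders_def)

lemma bv_eq_binders: "bv \<Phi> = set_mset (binders \<Phi>)"
  by (auto simp: bv_def binders_def set_mset_binders_flower)

lemma bv_simps [simp]:
  "bv {#} = {}"
  "bv (add_mset \<phi> \<Phi>) = bv_flower \<phi> \<union> bv \<Phi>"
  "bv (\<Phi> + \<Psi>) = bv \<Phi> \<union> bv \<Psi>"
  by (auto simp: bv_def)

lemma
  fixes \<phi> :: "('p, 'v) flower" and \<gamma> :: "('p, 'v) garden"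
  shows finite_fv_flower: "finite (fv_flower \<phi>)"
  and finite_fv_garden: "finite (fv_garden \<gamma>)"
  by (induction \<phi> and \<gamma>) (auto simp: fv_def)

lemma finite_fv: "finite (fv \<Phi>)"
  by (auto simp: fv_def finite_fv_flower)

lemma finite_bv: "finite (bv \<Phi>)"
  by (simp add: bv_eq_binders)

section \<open>Effect of substitution on binders, arities and free variables\<close>

lemma subst_Garden [simp]:
  "subst_garden (Garden x \<Phi>) \<sigma> = Garden x (subst (override_on \<sigma> id (fset x)) \<Phi>)"
  by (simp add: subst_def)

declare subst_garden.simps [simp del]

lemma
  fixes \<phi> :: "('p, 'v) flower" and \<gamma> :: "('p, 'v) garden"
  shows binders_subst_flower [simp]: "binders_flower (subst_flower \<phi> \<sigma>) = binders_flower \<phi>"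
  and binders_subst_garden [simp]: "binders_garden (subst_garden \<gamma> \<sigma>) = binders_garden \<gamma>"
  by (induction \<phi> and \<gamma> arbitrary: \<sigma> and \<sigma>)
    (auto simp: binders_def subst_def image_mset.compositionality comp_def
      cong: image_mset_cong)

lemma binders_subst [simp]: "binders (subst \<sigma> \<Phi>) = binders \<Phi>"
  by (simp add: binders_def subst_def image_mset.compositionality comp_def)

lemma
  fixes \<phi> :: "('p, 'v) flower" and \<gamma> :: "('p, 'v) garden"
  shows arity_subst_flower [simp]: "arity_flower ar (subst_flower \<phi> \<sigma>) = arity_flower ar \<phi>"
  and arity_subst_garden [simp]: "arity_garden ar (subst_garden \<gamma> \<sigma>) = arity_garden ar \<gamma>"
  by (induction \<phi> and \<gamma> arbitrary: \<sigma> and \<sigma>) (auto simp: arity_bouquet_def subst_def)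

lemma arity_subst [simp]: "arity_bouquet ar (subst \<sigma> \<Phi>) = arity_bouquet ar \<Phi>"
  by (simp add: arity_bouquet_def subst_def)

text \<open>No variable outside \<open>X\<close> is sent into \<open>X\<close>, and those inside are
  fixed by the override and then removed. Hence shielding binders from \<sigma> and removing them
  commutes with taking images.\<close>

lemma diff_image_override_on:
  assumes "\<And>v. \<sigma> v \<noteq> v \<Longrightarrow> \<sigma> v \<notin> X"
  shows "override_on \<sigma> id X ` A - X = \<sigma> ` (A - X)"
proof -
  have "\<sigma> v \<notin> X" if "v \<notin> X" for v
    using assms[of v] that by (cases "\<sigma> v = v") auto
  then show ?thesis
    by (auto simp: override_on_def image_iff split: if_splits)
qed

text \<open>The hypothesis restricts only variables that \<sigma> actually moves, since identity
  values cannot cause capture. This makes it pass to the overridden substitutions used below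
  sprinklers.\<close>

lemma
  fixes \<phi> :: "('p, 'v) flower" and \<gamma> :: "('p, 'v) garden"
  shows fv_subst_flower:
    "(\<And>v. \<sigma> v \<noteq> v \<Longrightarrow> \<sigma> v \<notin> bv_flower \<phi>) \<Longrightarrow> fv_flower (subst_flower \<phi> \<sigma>) = \<sigma> ` fv_flower \<phi>"
  and fv_subst_garden:
    "(\<And>v. \<sigma> v \<noteq> v \<Longrightarrow> \<sigma> v \<notin> bv_garden \<gamma>) \<Longrightarrow> fv_garden (subst_garden \<gamma> \<sigma>) = \<sigma> ` fv_garden \<gamma>"
proof (induction \<phi> and \<gamma> arbitrary: \<sigma> and \<sigma>)
  case (Atom p xs)
  then show ?case by simp
next
  case (Flower \<gamma> \<Delta>)
  let ?X = "fset (sprinkler \<gamma>)" and ?\<tau> = "override_on \<sigma> id (fset (sprinkler \<gamma>))"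
  have sp: "sprinkler (subst_garden \<gamma> \<sigma>) = sprinkler \<gamma>" "?X \<subseteq> bv_garden \<gamma>"
    by (cases \<gamma>; auto)+
  have \<gamma>: "fv_garden (subst_garden \<gamma> \<sigma>) = \<sigma> ` fv_garden \<gamma>"
    using Flower by auto
  have \<delta>: "fv_garden (subst_garden \<delta> ?\<tau>) = ?\<tau> ` fv_garden \<delta>" if "\<delta> \<in># \<Delta>" for \<delta>
  proof (rule Flower.IH(2)[OF that])
    \<comment> \<open>Whatever \<open>?\<tau>\<close> moves, \<sigma> moves to the same variable, so
      capture avoidance is inherited.\<close>
    show "?\<tau> v \<notin> bv_garden \<delta>" if "?\<tau> v \<noteq> v" for v
      using that \<open>\<delta> \<in># \<Delta>\<close> Flower.prems[of v] by (auto simp: override_on_def split: if_splits)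
  qed
  have "?\<tau> ` (\<Union>\<delta>\<in>set_mset \<Delta>. fv_garden \<delta>) - ?X = \<sigma> ` ((\<Union>\<delta>\<in>set_mset \<Delta>. fv_garden \<delta>) - ?X)"
    using Flower.prems sp(2) by (intro diff_image_override_on) auto
  then show ?case
    using \<gamma> \<delta> by (simp add: sp image_Un image_UN)
next
  case (Garden x \<Phi>)
  let ?\<tau> = "override_on \<sigma> id (fset x)"
  have "fv (subst ?\<tau> \<Phi>) = ?\<tau> ` fv \<Phi>"
  proof -
    have "fv_flower (subst_flower \<phi> ?\<tau>) = ?\<tau> ` fv_flower \<phi>" if "\<phi> \<in># \<Phi>" for \<phi>
    proof (rule Garden.IH[OF that])
      show "?\<tau> v \<notin> bv_flower \<phi>" if "?\<tau> v \<noteq> v" for v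
        using that \<open>\<phi> \<in># \<Phi>\<close> Garden.prems[of v]
        by (auto simp: override_on_def bv_def split: if_splits)
    qed
    then show ?thesis
      by (simp add: fv_def subst_def image_UN)
  qed
  then show ?case
    using Garden.prems by (simp add: diff_image_override_on)
qed

lemma fv_subst:
  "(\<And>v. \<sigma> v \<noteq> v \<Longrightarrow> \<sigma> v \<notin> bv \<Phi>) \<Longrightarrow> fv (subst \<sigma> \<Phi>) = \<sigma> ` fv \<Phi>"
  by (auto simp: fv_def subst_def bv_def fv_subst_flower)


section \<open>Contexts\<close>

lemma ctx_comp_ctx_add: "ctx_comp (ctx_add \<Psi> \<Xi>) \<Xi>' = ctx_add \<Psi> (ctx_comp \<Xi> \<Xi>')"
proof -
  have "ctx_add (A + B) \<Theta> = ctx_add A (ctx_add B \<Theta>)" for A B and \<Theta> :: "('a, 'b) ctx"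
    by (cases \<Theta>) (simp add: add.assoc)
  then show ?thesis by (cases \<Xi>) simp
qed

lemma ctx_comp_assoc:
  "ctx_comp (ctx_comp \<Xi> \<Xi>') \<Xi>'' = ctx_comp \<Xi> (ctx_comp \<Xi>' \<Xi>'')"
  "ctx_comp (fctx_comp \<xi> \<Xi>') \<Xi>'' = fctx_comp \<xi> (ctx_comp \<Xi>' \<Xi>'')"
  by (induction \<Xi> and \<xi>) (simp_all add: ctx_comp_ctx_add)

text \<open>The binders whose scope contains the hole. A petal lies in the scope of its pistil's
  sprinkler, so \<open>InPetal\<close> contributes two sprinklers; the binders of petals do not
  reach a hole in the pistil.\<close>

primrec captured :: "('p, 'v) ctx \<Rightarrow> 'v set"
  and captured_fctx :: "('p, 'v) fctx \<Rightarrow> 'v set" where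
  "captured (Ctx \<Psi> \<xi>) = captured_fctx \<xi>"
| "captured_fctx Hole = {}"
| "captured_fctx (InPistil x \<Xi> \<Delta>) = fset x \<union> captured \<Xi>"
| "captured_fctx (InPetal \<gamma> x \<Xi> \<Delta>) = fset (sprinkler \<gamma>) \<union> fset x \<union> captured \<Xi>"

lemma captured_ctx_add [simp]: "captured (ctx_add \<Psi> \<Xi>) = captured \<Xi>"
  by (cases \<Xi>) simp

lemma captured_ctx_comp:
  "captured (ctx_comp \<Xi> \<Xi>') = captured \<Xi> \<union> captured \<Xi>'"
  "captured (fctx_comp \<xi> \<Xi>') = captured_fctx \<xi> \<union> captured \<Xi>'"
  by (induction \<Xi> and \<xi>) auto

lemma fv_fill:
  "fv (fill \<Xi> \<Phi>) = fv (fill \<Xi> {#}) \<union> (fv \<Phi> - captured \<Xi>)"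
  "fv (fill_fctx \<xi> \<Phi>) = fv (fill_fctx \<xi> {#}) \<union> (fv \<Phi> - captured_fctx \<xi>)"
  by (induction \<Xi> and \<xi>) auto

lemma binders_fill:
  "binders (fill \<Xi> \<Phi>) = binders (fill \<Xi> {#}) + binders \<Phi>"
  "binders (fill_fctx \<xi> \<Phi>) = binders (fill_fctx \<xi> {#}) + binders \<Phi>"
  by (induction \<Xi> and \<xi>) auto

lemma arity_fill:
  "arity_bouquet ar (fill \<Xi> \<Phi>) \<longleftrightarrow> arity_bouquet ar (fill \<Xi> {#}) \<and> arity_bouquet ar \<Phi>"
  "arity_bouquet ar (fill_fctx \<xi> \<Phi>) \<longleftrightarrow> arity_bouquet ar (fill_fctx \<xi> {#}) \<and> arity_bouquet ar \<Phi>"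
  by (induction \<Xi> and \<xi>) auto

text \<open>Shrinking the filling can only shrink the binders and free variables of the whole, and
  the clauses on multiplicity and disjointness survive shrinking. Only arities need a separate
  hypothesis.\<close>

lemma legal_fill_mono:
  assumes "legal ar (fill \<Xi> \<Phi>)" "binders \<Psi> \<subseteq># binders \<Phi>" "fv \<Psi> \<subseteq> fv \<Phi>"
    "arity_bouquet ar \<Psi>"
  shows "legal ar (fill \<Xi> \<Psi>)"
proof -
  have sub: "binders (fill \<Xi> \<Psi>) \<subseteq># binders (fill \<Xi> \<Phi>)"
    using assms(2) by (simp add: binders_fill(1)[of _ \<Phi>] binders_fill(1)[of _ \<Psi>])
  have "bv (fill \<Xi> \<Psi>) \<subseteq> bv (fill \<Xi> \<Phi>)"
    using set_mset_mono[OF sub] by (simp add: bv_eq_binders)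
  moreover have "fv (fill \<Xi> \<Psi>) \<subseteq> fv (fill \<Xi> \<Phi>)"
    using assms(3) fv_fill(1)[of \<Xi> \<Phi>] fv_fill(1)[of \<Xi> \<Psi>] by blast
  moreover have "arity_bouquet ar (fill \<Xi> \<Psi>)"
    using assms(1,4) arity_fill(1)[of ar \<Xi> \<Phi>] arity_fill(1)[of ar \<Xi> \<Psi>]
    by (simp add: legal_def)
  moreover have "count (binders (fill \<Xi> \<Psi>)) v \<le> 1" for v
    using assms(1) mset_subset_eq_count[OF sub, of v] by (meson legal_def order_trans)
  ultimately show ?thesis
    using assms(1) unfolding legal_def by blast
qed

text \<open>A single flower is filled in because of \<open>Hole\<close>, which returns the filling
  itself; the other cases give one flower for any filling.\<close>

lemma fill_fctx_singleton: "\<exists>\<psi>. fill_fctx \<xi> {#\<phi>#} = {#\<psi>#}"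
  by (cases \<xi>) auto


section \<open>Renaming\<close>

text \<open>The renaming step stripped of its context, with the old and new binder exposed so that
  the exchange of binders can be tracked.\<close>

inductive rename_redex :: "'v \<Rightarrow> 'v \<Rightarrow> ('p, 'v) flower \<Rightarrow> ('p, 'v) flower \<Rightarrow> bool" for u w where
  pistil: "\<lbrakk> u |\<in>| x; w \<notin> fv_flower (Flower (Garden x \<Phi>) \<Delta>) \<union> bv_flower (Flower (Garden x \<Phi>) \<Delta>) \<rbrakk> \<Longrightarrow>
    rename_redex u w (Flower (Garden x \<Phi>) \<Delta>)
      (Flower (Garden (finsert w (x |-| {|u|})) (subst (id(u := w)) \<Phi>))
         (subst_corolla (id(u := w)) \<Delta>))"
| petal: "\<lbrakk> u |\<in>| x; w \<notin> fv_garden (Garden x \<Phi>) \<union> bv_garden (Garden x \<Phi>) \<rbrakk> \<Longrightarrow>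
    rename_redex u w (Flower \<gamma> (add_mset (Garden x \<Phi>) \<Delta>))
      (Flower \<gamma> (add_mset (Garden (finsert w (x |-| {|u|})) (subst (id(u := w)) \<Phi>)) \<Delta>))"

lemma rename_step_iff_redex:
  "rename_step A B \<longleftrightarrow>
     (\<exists>\<Xi> u w \<phi> \<phi>'. rename_redex u w \<phi> \<phi>' \<and> A = fill \<Xi> {#\<phi>#} \<and> B = fill \<Xi> {#\<phi>'#})"
proof
  assume "rename_step A B"
  then show "\<exists>\<Xi> u w \<phi> \<phi>'. rename_redex u w \<phi> \<phi>' \<and> A = fill \<Xi> {#\<phi>#} \<and> B = fill \<Xi> {#\<phi>'#}"
  proof cases
    case pistil
    then show ?thesis by (blast intro: rename_redex.pistil)
  next
    case petal
    then show ?thesis by (blast intro: rename_redex.petal)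
  qed
next
  assume "\<exists>\<Xi> u w \<phi> \<phi>'. rename_redex u w \<phi> \<phi>' \<and> A = fill \<Xi> {#\<phi>#} \<and> B = fill \<Xi> {#\<phi>'#}"
  then obtain \<Xi> u w \<phi> \<phi>' where "rename_redex u w \<phi> \<phi>'" and AB: "A = fill \<Xi> {#\<phi>#}" "B = fill \<Xi> {#\<phi>'#}"
    by blast
  then show "rename_step A B"
    by (cases) (simp_all add: AB rename_step.intros del: fv_flower.simps bv_flower.simps Garden_simps)
qed

lemma rename_step_fill: "rename_step A B \<Longrightarrow> rename_step (fill \<Xi> A) (fill \<Xi> B)"
  unfolding rename_step_iff_redex by (metis fill_ctx_comp(1))

lemma alpha_refl [simp]: "alpha A A"
  by (simp add: alpha_def)

lemma alpha_sym: "alpha A B \<Longrightarrow> alpha B A"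
  by (simp add: alpha_def equivclp_sym)

lemma alpha_trans: "alpha A B \<Longrightarrow> alpha B C \<Longrightarrow> alpha A C"
  unfolding alpha_def by (rule equivclp_trans)

lemma rename_step_imp_alpha: "rename_step A B \<or> rename_step B A \<Longrightarrow> alpha A B"
  unfolding alpha_def by (meson equivclp_sym r_into_equivclp)

lemma alpha_induct [consumes 1, case_names refl step]:
  assumes "alpha A B" "P A"
    "\<And>y z. \<lbrakk> alpha A y; rename_step y z \<or> rename_step z y; P y \<rbrakk> \<Longrightarrow> P z"
  shows "P B"
  using assms unfolding alpha_def by (rule equivclp_induct)

lemma alpha_fill: "alpha A B \<Longrightarrow> alpha (fill \<Xi> A) (fill \<Xi> B)"
proof (induction rule: alpha_induct)
  case (step y z)
  then show ?case
    by (meson alpha_trans rename_step_fill rename_step_imp_alpha)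
qed simp

text \<open>Here \<open>A\<close> stands for the free variables of the scope and \<open>X\<close>
  for the sprinkler. Occurrences of \<open>u\<close> become \<open>w\<close>, which the new
  sprinkler binds; as \<open>w\<close> was not free in the scope, nothing else is captured.\<close>

lemma fv_rename_scope:
  assumes "u \<in> X" "w \<notin> A - X"
  shows "(id(u := w)) ` A - insert w (X - {u}) = A - X"
  using assms by (auto simp: image_iff fun_upd_def split: if_splits)

lemma fv_rename_redex: "rename_redex u w \<phi> \<phi>' \<Longrightarrow> fv_flower \<phi>' = fv_flower \<phi>"
proof (induction rule: rename_redex.induct)
  case (pistil x \<Phi> \<Delta>)
  let ?\<sigma> = "id(u := w)" and ?D = "\<Union>\<delta>\<in>set_mset \<Delta>. fv_garden \<delta>"
  have "fv (subst ?\<sigma> \<Phi>) = ?\<sigma> ` fv \<Phi>"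
    using pistil by (intro fv_subst) (auto split: if_splits)
  moreover have "fv_garden (subst_garden \<delta> ?\<sigma>) = ?\<sigma> ` fv_garden \<delta>" if "\<delta> \<in># \<Delta>" for \<delta>
    using pistil that by (intro fv_subst_garden) (auto split: if_splits)
  then have "(\<Union>\<delta>\<in>set_mset \<Delta>. fv_garden (subst_garden \<delta> ?\<sigma>)) = ?\<sigma> ` ?D"
    unfolding image_UN by (rule SUP_cong[OF refl])
  moreover have "u \<in> fset x" "w \<notin> fv \<Phi> - fset x" "w \<notin> ?D - fset x"
    using pistil by auto
  note fv_rename_scope[OF this(1,2)] fv_rename_scope[OF this(1,3)]
  ultimately show ?case
    by (simp add: subst_corolla_def)
next
  case (petal x \<Phi> \<gamma> \<Delta>)
  have "fv (subst (id(u := w)) \<Phi>) = (id(u := w)) ` fv \<Phi>"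
    using petal by (intro fv_subst) (auto split: if_splits)
  moreover have "u \<in> fset x" "w \<notin> fv \<Phi> - fset x"
    using petal by auto
  note fv_rename_scope[OF this]
  ultimately show ?case
    by simp
qed

lemma arity_rename_redex: "rename_redex u w \<phi> \<phi>' \<Longrightarrow> arity_flower ar \<phi>' = arity_flower ar \<phi>"
  by (induction rule: rename_redex.induct) (auto simp: subst_corolla_def)

text \<open>One copy of \<open>u\<close> is traded for one copy of \<open>w\<close>, as
  \<open>w\<close> is not yet in the sprinkler. Adding on both sides avoids multiset
  subtraction.\<close>

lemma binders_rename_redex:
  assumes "rename_redex u w \<phi> \<phi>'"
  shows "add_mset u (binders_flower \<phi>') = add_mset w (binders_flower \<phi>)"
proof -
  have sprinkler: "add_mset u (mset_set (fset x - {u})) = mset_set (fset x)" if "u |\<in>| x" for x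
    using that by (simp add: mset_set.remove[of "fset x" u])
  show ?thesis
    using assms
    by (induction rule: rename_redex.induct)
      (simp_all add: subst_corolla_def image_mset.compositionality comp_def sprinkler)
qed

text \<open>By \<open>fv_fill\<close> a context sees only the free variables of its filling, so it
  suffices that a redex preserves them.\<close>

lemma fv_alpha: "alpha A B \<Longrightarrow> fv A = fv B"
proof (induction rule: alpha_induct)
  case (step y z)
  have "fv A = fv B" if "rename_step A B" for A B :: "('a, 'b) bouquet"
    using that unfolding rename_step_iff_redex
    by (auto simp: fv_fill(1)[where \<Phi> = "{#_#}"] fv_rename_redex)
  then show ?case
    using step by metis
qed simp

lemma arity_alpha: "alpha A B \<Longrightarrow> arity_bouquet ar A = arity_bouquet ar B"
proof (induction rule: alpha_induct)
  case (step y z)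
  have "arity_bouquet ar A = arity_bouquet ar B" if "rename_step A B" for A B :: "('a, 'b) bouquet"
    using that unfolding rename_step_iff_redex
    by (auto simp: arity_fill(1)[where \<Phi> = "{#_#}"] arity_rename_redex)
  then show ?case
    using step by metis
qed simp

lemma rename_step_singletons:
  assumes "rename_step A B"
  obtains \<Theta> \<phi> \<psi> where "A = add_mset \<phi> \<Theta>" "B = add_mset \<psi> \<Theta>" "rename_step {#\<phi>#} {#\<psi>#}"
proof -
  obtain \<Theta> \<xi> u w \<phi> \<phi>' where R: "rename_redex u w \<phi> \<phi>'" "A = fill (Ctx \<Theta> \<xi>) {#\<phi>#}" "B = fill (Ctx \<Theta> \<xi>) {#\<phi>'#}"
    using assms unfolding rename_step_iff_redex by (metis ctx.exhaust)
  obtain \<psi> \<psi>' where \<psi>: "fill_fctx \<xi> {#\<phi>#} = {#\<psi>#}" "fill_fctx \<xi> {#\<phi>'#} = {#\<psi>'#}"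
    using fill_fctx_singleton by metis
  have "rename_step {#\<psi>#} {#\<psi>'#}"
    unfolding rename_step_iff_redex using R(1) \<psi>
    by (intro exI[of _ "Ctx {#} \<xi>"]) (metis add_0 fill.simps)
  then show thesis
    using that[of \<psi> \<Theta> \<psi>'] R \<psi> by simp
qed

text \<open>Each renaming step alters one top-level flower only, so a flower can be followed along
  the chain of steps. This transfers pollinability, which is defined flower by flower.\<close>

lemma alpha_member:
  assumes "alpha A B" "\<phi> \<in># A"
  shows "\<exists>\<psi> \<in># B. alpha {#\<phi>#} {#\<psi>#}"
  using assms
proof (induction rule: alpha_induct)
  case refl
  then show ?case by (auto intro: alpha_refl)
next
  case (step y z)
  then obtain \<psi> where \<psi>: "\<psi> \<in># y" "alpha {#\<phi>#} {#\<psi>#}"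
    by blast
  obtain \<Theta> \<chi> \<chi>' where \<chi>: "y = add_mset \<chi> \<Theta>" "z = add_mset \<chi>' \<Theta>" "alpha {#\<chi>#} {#\<chi>'#}"
    using step(2) by (metis rename_step_singletons rename_step_imp_alpha)
  show ?case
  proof (cases "\<psi> = \<chi>")
    case True
    then show ?thesis
      using \<psi> \<chi> alpha_trans by auto
  next
    case False
    then show ?thesis
      using \<psi> \<chi> by auto
  qed
qed

section \<open>Renaming inside an implication\<close>

lemma alpha_imp:
  assumes "alpha \<Psi> \<Psi>'" "alpha \<Phi> \<Phi>'"
  shows "alpha {#imp \<Psi> \<Phi>#} {#imp \<Psi>' \<Phi>'#}"
proof -
  \<comment> \<open>The pistil is renamed first, beside the old petal; then the petal, beside the
    new pistil.\<close>
  let ?pistil = "Ctx {#} (InPistil {||} (Ctx {#} Hole) {#Garden {||} \<Phi>#})"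
  let ?petal = "Ctx {#} (InPetal (Garden {||} \<Psi>') {||} (Ctx {#} Hole) {#})"
  have "alpha (fill ?pistil \<Psi>) (fill ?pistil \<Psi>')" "alpha (fill ?petal \<Phi>) (fill ?petal \<Phi>')"
    using assms by (blast intro: alpha_fill)+
  then show ?thesis
    by (auto simp: imp_def intro: alpha_trans)
qed

text \<open>The sprinkler being renamed contains \<open>u\<close> before and \<open>w\<close> after,
  whereas both sprinklers of an implication are empty. Renaming must therefore happen strictly
  inside.\<close>

lemma rename_redex_not_imp:
  assumes "rename_redex u w \<phi> \<phi>'"
  shows "\<phi> \<noteq> imp \<Psi> \<Phi>" "\<phi>' \<noteq> imp \<Psi> \<Phi>"
  using assms by (auto simp: imp_def elim!: rename_redex.cases)

lemma fill_eq_imp_cases: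
  assumes "fill \<Xi> {#\<phi>#} = {#imp \<Psi> \<Phi>#}" "\<phi> \<noteq> imp \<Psi> \<Phi>"
  obtains \<Xi>' where "fill \<Xi>' {#\<phi>#} = \<Psi>" "\<And>\<Theta>. fill \<Xi> \<Theta> = {#imp (fill \<Xi>' \<Theta>) \<Phi>#}"
    | \<Xi>' where "fill \<Xi>' {#\<phi>#} = \<Phi>" "\<And>\<Theta>. fill \<Xi> \<Theta> = {#imp \<Psi> (fill \<Xi>' \<Theta>)#}"
proof -
  obtain \<Theta> \<xi> where \<Xi>: "\<Xi> = Ctx \<Theta> \<xi>" by (cases \<Xi>)
  obtain \<psi> where "fill_fctx \<xi> {#\<phi>#} = {#\<psi>#}"
    using fill_fctx_singleton by metis
  then have "\<Theta> = {#}"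
    using assms(1) \<Xi> by (simp add: single_is_union)
  then show thesis
    using assms that \<Xi> by (cases \<xi>) (auto simp: imp_def)
qed

lemma rename_step_imp_cases:
  assumes "rename_step {#imp \<Psi> \<Phi>#} B \<or> rename_step B {#imp \<Psi> \<Phi>#}"
  shows "\<exists>\<Psi>' \<Phi>'. B = {#imp \<Psi>' \<Phi>'#} \<and> alpha \<Psi> \<Psi>' \<and> alpha \<Phi> \<Phi>'"
proof -
  obtain \<Xi> u w \<phi> \<phi>' where R: "rename_redex u w \<phi> \<phi>' \<or> rename_redex u w \<phi>' \<phi>"
    "fill \<Xi> {#\<phi>#} = {#imp \<Psi> \<Phi>#}" "B = fill \<Xi> {#\<phi>'#}"
    using assms unfolding rename_step_iff_redex by metis
  have al: "alpha (fill \<Xi>' {#\<phi>#}) (fill \<Xi>' {#\<phi>'#})" for \<Xi>'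
    using R(1) by (intro rename_step_imp_alpha) (metis rename_step_iff_redex)
  have "\<phi> \<noteq> imp \<Psi> \<Phi>"
    using R(1) rename_redex_not_imp by metis
  from fill_eq_imp_cases[OF R(2) this] show ?thesis
    using R(3) al by (metis alpha_refl)
qed

text \<open>Inversion of \<open>alpha_imp\<close>, needed because provability of an implication
  ranges over all its representatives.\<close>

lemma alpha_imp_cases:
  assumes "alpha {#imp \<Psi> \<Phi>#} B"
  shows "\<exists>\<Psi>' \<Phi>'. B = {#imp \<Psi>' \<Phi>'#} \<and> alpha \<Psi> \<Psi>' \<and> alpha \<Phi> \<Phi>'"
  using assms
proof (induction rule: alpha_induct)
  case refl
  then show ?case by (auto intro: alpha_refl)
next
  case (step y z)
  then show ?case
    by (metis rename_step_imp_cases alpha_trans)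
qed

section \<open>Making binders fresh\<close>

definition renames :: "'v \<Rightarrow> 'v \<Rightarrow> ('p, 'v) bouquet \<Rightarrow> ('p, 'v) bouquet \<Rightarrow> bool" where
  "renames u w A B \<longleftrightarrow> rename_step A B \<and> add_mset u (binders B) = add_mset w (binders A)"

lemma renames_fill: "renames u w A B \<Longrightarrow> renames u w (fill \<Xi> A) (fill \<Xi> B)"
  by (simp add: renames_def rename_step_fill binders_fill(1)[of _ A] binders_fill(1)[of _ B]
      flip: union_mset_add_mset_right)

lemma renames_redex: "rename_redex u w \<phi> \<phi>' \<Longrightarrow> renames u w {#\<phi>#} {#\<phi>'#}"
  unfolding renames_def rename_step_iff_redex
  by (intro conjI exI[of _ "Ctx {#} Hole"] exI[of _ u] exI[of _ w])
    (simp_all add: binders_rename_redex flip: union_mset_add_mset_left)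

text \<open>A garden cannot rename its own sprinkler in isolation: if it is a pistil, the petals
  must be renamed with it. The garden case thus only reports that \<open>u\<close> is bound at its
  root and leaves the renaming to the enclosing flower.\<close>

lemma
  fixes \<phi> :: "('p, 'v) flower" and \<gamma> :: "('p, 'v) garden"
  shows ex_renames_flower:
    "\<lbrakk> u \<in> bv_flower \<phi>; w \<notin> fv_flower \<phi> \<union> bv_flower \<phi> \<rbrakk> \<Longrightarrow> \<exists>B. renames u w {#\<phi>#} B"
  and ex_renames_garden:
    "\<lbrakk> u \<in> bv_garden \<gamma>; w \<notin> fv_garden \<gamma> \<union> bv_garden \<gamma> \<rbrakk> \<Longrightarrow>
     u |\<in>| sprinkler \<gamma> \<or> (\<exists>B. renames u w (contents \<gamma>) B)"
proof (induction \<phi> and \<gamma>)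
  case (Atom p xs)
  then show ?case by simp
next
  case (Flower \<gamma> \<Delta>)
  obtain x \<Phi> where \<gamma>: "\<gamma> = Garden x \<Phi>" by (cases \<gamma>)
  from Flower.prems consider "u \<in> bv_garden \<gamma>" | \<delta> where "\<delta> \<in># \<Delta>" "u \<in> bv_garden \<delta>"
    by auto
  then show ?case
  proof cases
    case 1
    moreover have "w \<notin> fv_garden \<gamma> \<union> bv_garden \<gamma>"
      using Flower.prems by simp
    ultimately consider "u |\<in>| x" | B where "renames u w \<Phi> B"
      using Flower.IH(1) \<gamma> by auto
    then show ?thesis
    proof cases
      case 1
      then show ?thesis
        using Flower.prems(2) renames_redex[OF rename_redex.pistil] \<gamma> by metis
    next
      case 2
      then show ?thesis
        using renames_fill[of u w \<Phi> B "Ctx {#} (InPistil x (Ctx {#} Hole) \<Delta>)"] \<gamma> by auto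
    qed
  next
    case 2
    obtain \<Delta>' where \<Delta>: "\<Delta> = add_mset \<delta> \<Delta>'"
      using 2 by (metis multi_member_split)
    obtain y \<Psi> where \<delta>: "\<delta> = Garden y \<Psi>" by (cases \<delta>)
    have w: "w \<notin> fv_garden \<delta> \<union> bv_garden \<delta>"
      using Flower.prems 2 \<gamma> by auto
    with 2 consider "u |\<in>| y" | B where "renames u w \<Psi> B"
      using Flower.IH(2) \<delta> by fastforce
    then show ?thesis
    proof cases
      case 1
      then show ?thesis
        using w renames_redex[OF rename_redex.petal] \<delta> \<Delta> by metis
    next
      case 2
      then show ?thesis
        using renames_fill[of u w \<Psi> B "Ctx {#} (InPetal \<gamma> y (Ctx {#} Hole) \<Delta>')"] \<delta> \<Delta> by auto
    qed
  qed
next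
  case (Garden x \<Phi>)
  show ?case
  proof (cases "u |\<in>| x")
    case False
    then obtain \<phi> where \<phi>: "\<phi> \<in># \<Phi>" "u \<in> bv_flower \<phi>"
      using Garden.prems by (auto simp: bv_def)
    moreover have "w \<notin> fv_flower \<phi> \<union> bv_flower \<phi>"
      using Garden.prems \<phi> by (auto simp: bv_def fv_def)
    ultimately obtain B where "renames u w {#\<phi>#} B"
      using Garden.IH by blast
    moreover obtain \<Phi>' where "\<Phi> = add_mset \<phi> \<Phi>'"
      using \<phi> by (metis multi_member_split)
    ultimately show ?thesis
      using renames_fill[of u w "{#\<phi>#}" B "Ctx \<Phi>' Hole"] by auto
  qed simp
qed

lemma ex_renames:
  assumes "u \<in> bv \<Phi>" "w \<notin> fv \<Phi> \<union> bv \<Phi>"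
  shows "\<exists>B. renames u w \<Phi> B"
  \<comment> \<open>The empty sprinkler rules out that \<open>u\<close> is bound at the
    root.\<close>
  using ex_renames_garden[of u "Garden {||} \<Phi>" w] assms by simp

lemma ex_alpha_fresh:
  fixes \<Psi> :: "('p, 'v) bouquet"
  assumes "infinite (UNIV :: 'v set)" "finite S" "\<And>x. count (binders \<Psi>) x \<le> 1"
  shows "\<exists>\<Psi>'. alpha \<Psi> \<Psi>' \<and> bv \<Psi>' \<inter> S = {} \<and> (\<forall>x. count (binders \<Psi>') x \<le> 1)"
  using assms(3) \<comment> \<open>each renaming step removes one binder from \<open>S\<close>\<close>
proof (induction "size (filter_mset (\<lambda>v. v \<in> S) (binders \<Psi>))" arbitrary: \<Psi> rule: less_induct)
  case less
  show ?case
  proof (cases "bv \<Psi> \<inter> S = {}")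
    case True
    then show ?thesis
      using less.prems alpha_refl by metis
  next
    case False
    then obtain u where u: "u \<in> bv \<Psi>" "u \<in> S" by blast
    obtain w where w: "w \<notin> fv \<Psi> \<union> bv \<Psi> \<union> S"
      using ex_new_if_finite[OF assms(1)] assms(2) finite_fv finite_bv by (metis finite_UnI)
    obtain B where B: "rename_step \<Psi> B" "add_mset u (binders B) = add_mset w (binders \<Psi>)"
      using ex_renames[OF u(1)] w unfolding renames_def by blast
    have "filter_mset (\<lambda>v. v \<in> S) (add_mset u (binders B)) = filter_mset (\<lambda>v. v \<in> S) (add_mset w (binders \<Psi>))"
      using B(2) by simp
    then have "add_mset u (filter_mset (\<lambda>v. v \<in> S) (binders B)) = filter_mset (\<lambda>v. v \<in> S) (binders \<Psi>)"
      using u w by simp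
    then have "size (filter_mset (\<lambda>v. v \<in> S) (binders B)) < size (filter_mset (\<lambda>v. v \<in> S) (binders \<Psi>))"
      by (metis lessI size_add_mset)
    \<comment> \<open>As \<open>w\<close> was not a binder before, it now occurs exactly
      once.\<close>
    moreover have "count (binders B) v \<le> 1" for v
    proof -
      have "count (binders \<Psi>) w = 0"
        using w by (simp add: bv_eq_binders count_eq_zero_iff)
      then show ?thesis
        using arg_cong[OF B(2), of "\<lambda>M. count M v"] less.prems[of v] by (auto split: if_splits)
    qed
    ultimately obtain \<Psi>' where "alpha B \<Psi>'" "bv \<Psi>' \<inter> S = {}" "\<forall>x. count (binders \<Psi>') x \<le> 1"
      using less.hyps by blast
    then show ?thesis
      using B(1) alpha_trans rename_step_imp_alpha by metis
  qed
qed


section \<open>Pollination and natural steps\<close>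

text \<open>The source of pollination stays in place while the hole moves deeper: only the inner
  context of the decomposition is extended.\<close>

lemma flower_pollinable_ctx_comp:
  assumes "flower_pollinable \<phi> \<Xi>"
  shows "flower_pollinable \<phi> (ctx_comp \<Xi> \<Xi>')"
proof -
  obtain \<Psi> \<Xi>1 \<Xi>0 where \<Psi>: "\<exists>\<phi>' \<in># \<Psi>. alpha {#\<phi>#} {#\<phi>'#}"
    and \<Xi>: "\<Xi> = ctx_comp \<Xi>1 (ctx_add \<Psi> \<Xi>0) \<or>
      (\<exists>x y \<Delta>. \<Xi> = ctx_comp \<Xi>1 (Ctx {#} (InPetal (Garden x \<Psi>) y \<Xi>0 \<Delta>)))"
    using assms unfolding flower_pollinable_def by blast
  have "ctx_comp \<Xi> \<Xi>' = ctx_comp \<Xi>1 (ctx_add \<Psi> (ctx_comp \<Xi>0 \<Xi>')) \<or>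
      (\<exists>x y \<Delta>. ctx_comp \<Xi> \<Xi>' = ctx_comp \<Xi>1 (Ctx {#} (InPetal (Garden x \<Psi>) y (ctx_comp \<Xi>0 \<Xi>') \<Delta>)))"
    using \<Xi> by (force simp: ctx_comp_assoc ctx_comp_ctx_add)
  then show ?thesis
    unfolding flower_pollinable_def using \<Psi> by blast
qed

lemma pollinable_ctx_comp: "pollinable \<Phi> \<Xi> \<Longrightarrow> pollinable \<Phi> (ctx_comp \<Xi> \<Xi>')"
  by (simp add: pollinable_def flower_pollinable_ctx_comp)

lemma pollinable_alpha:
  assumes "pollinable \<Phi> \<Xi>" "alpha \<Phi> \<Phi>'"
  shows "pollinable \<Phi>' \<Xi>"
  unfolding pollinable_def
proof
  fix \<phi>' assume "\<phi>' \<in># \<Phi>'"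
  then obtain \<phi> where "\<phi> \<in># \<Phi>" "alpha {#\<phi>'#} {#\<phi>#}"
    using assms(2) alpha_member alpha_sym by metis
  then show "flower_pollinable \<phi>' \<Xi>"
    using assms(1) alpha_trans unfolding pollinable_def flower_pollinable_def by meson
qed

lemma pollinable_petal:
  assumes "alpha \<Psi> \<Psi>'"
  shows "pollinable \<Psi> (ctx_comp \<Xi> (Ctx {#} (InPetal (Garden x \<Psi>') y \<Xi>' \<Delta>)))"
  unfolding pollinable_def flower_pollinable_def using alpha_member[OF assms] by blast

text \<open>A variant of each flower already stands in the context, with the same free variables.
  All binders above that occurrence also lie above the hole, so they are among the captured
  ones.\<close>

lemma fv_pollinable:
  assumes "pollinable \<Phi> \<Xi>"
  shows "fv \<Phi> - captured \<Xi> \<subseteq> fv (fill \<Xi> {#})"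
proof -
  have "fv_flower \<phi> - captured \<Xi> \<subseteq> fv (fill \<Xi> {#})" if \<phi>: "\<phi> \<in># \<Phi>" for \<phi>
  proof -
    obtain \<Psi> \<Xi>1 \<Xi>0 \<phi>' where \<Psi>: "\<phi>' \<in># \<Psi>" "alpha {#\<phi>#} {#\<phi>'#}"
      and \<Xi>: "\<Xi> = ctx_comp \<Xi>1 (ctx_add \<Psi> \<Xi>0) \<or>
        (\<exists>x y \<Delta>. \<Xi> = ctx_comp \<Xi>1 (Ctx {#} (InPetal (Garden x \<Psi>) y \<Xi>0 \<Delta>)))"
      using assms \<phi> unfolding pollinable_def flower_pollinable_def by blast
    have "fv_flower \<phi> \<subseteq> fv \<Psi>"
      using \<Psi>(1) fv_alpha[OF \<Psi>(2)] by (auto simp: fv_def)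
    then show ?thesis
      using \<Xi> fv_fill(1)[of \<Xi>1 "fill (ctx_add \<Psi> \<Xi>0) {#}"]
        fv_fill(1)[of \<Xi>1 "fill (Ctx {#} (InPetal (Garden _ \<Psi>) _ \<Xi>0 _)) {#}"]
      by (auto simp: captured_ctx_comp fill_ctx_comp fill_ctx_add)
  qed
  then show ?thesis
    by (auto simp: fv_def[of \<Phi>])
qed

section \<open>The two directions of the equivalence\<close>

lemma nat_rule_imp_nat_step:
  assumes "nat_rule \<Phi> \<Psi>" "legal ar (fill \<Xi> \<Phi>)" "legal ar (fill \<Xi> \<Psi>)"
  shows "nat_step ar (fill \<Xi> \<Phi>) (fill \<Xi> \<Psi>)"
  using assms alpha_refl unfolding nat_step_def by blast

lemma provable_imp_if_hyp_provable:
  assumes "hyp_provable ar \<Psi> \<Phi>"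
  shows "provable ar {#imp \<Psi> \<Phi>#}"
  unfolding provable_def hyp_provable_def
proof (intro allI impI, elim conjE)
  fix \<Xi> B assume "alpha {#imp \<Psi> \<Phi>#} B" and legal: "legal ar (fill \<Xi> B)"
  then obtain \<Psi>' \<Phi>' where B: "B = {#imp \<Psi>' \<Phi>'#}" "alpha \<Psi> \<Psi>'" "alpha \<Phi> \<Phi>'"
    using alpha_imp_cases by blast
  \<comment> \<open>The hole is the petal of the implication, where the pistil \<Psi>' pollinates
    \<Psi>.\<close>
  let ?\<Xi> = "ctx_comp \<Xi> (Ctx {#} (InPetal (Garden {||} \<Psi>') {||} (Ctx {#} Hole) {#}))"
  have fill: "fill ?\<Xi> \<Theta> = fill \<Xi> {#imp \<Psi>' \<Theta>#}" for \<Theta>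
    by (simp add: fill_ctx_comp imp_def)
  have "(nat_step ar)\<^sup>*\<^sup>* (fill ?\<Xi> \<Phi>') (fill ?\<Xi> {#})"
    using assms pollinable_petal[OF B(2)] B(3) legal[unfolded B(1), folded fill]
    unfolding hyp_provable_def by blast
  moreover have "nat_step ar (fill \<Xi> {#imp \<Psi>' {#}#}) (fill \<Xi> {#})"
  proof (rule nat_rule_imp_nat_step)
    show "nat_rule {#imp \<Psi>' {#}#} {#}"
      unfolding imp_def by (rule epet)
    have "arity_bouquet ar {#imp \<Psi>' \<Phi>'#}"
      using legal B(1) arity_fill(1) unfolding legal_def by metis
    then show "legal ar (fill \<Xi> {#imp \<Psi>' {#}#})" "legal ar (fill \<Xi> {#})"
      using legal B(1) by (auto intro!: legal_fill_mono[of ar \<Xi> B] simp: imp_def)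
  qed
  ultimately show "(nat_step ar)\<^sup>*\<^sup>* (fill \<Xi> B) (fill \<Xi> {#})"
    using B(1) by (simp add: fill)
qed

lemma hyp_provable_if_provable_imp:
  fixes \<Psi> \<Phi> :: "('p, 'v) bouquet"
  assumes "infinite (UNIV :: 'v set)" "legal ar \<Psi>" "provable ar {#imp \<Psi> \<Phi>#}"
  shows "hyp_provable ar \<Psi> \<Phi>"
  unfolding hyp_provable_def
proof (intro allI impI, elim conjE)
  fix \<Xi> \<Phi>' assume poll: "pollinable \<Psi> \<Xi>" and "alpha \<Phi> \<Phi>'" and legal: "legal ar (fill \<Xi> \<Phi>')"
  let ?A = "fill \<Xi> \<Phi>'"
  \<comment> \<open>Avoiding \<open>bv ?A\<close> keeps binders distinct once \<Psi>' is inserted;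
    avoiding \<open>fv ?A\<close> keeps them apart from free variables.\<close>
  obtain \<Psi>' where \<Psi>': "alpha \<Psi> \<Psi>'" "bv \<Psi>' \<inter> (fv ?A \<union> bv ?A) = {}" "\<And>x. count (binders \<Psi>') x \<le> 1"
    using ex_alpha_fresh[OF assms(1), of "fv ?A \<union> bv ?A" \<Psi>] finite_fv finite_bv assms(2)
    unfolding legal_def by (metis finite_UnI)
  have poll': "pollinable \<Psi>' \<Xi>"
    using poll \<Psi>'(1) by (rule pollinable_alpha)
  \<comment> \<open>Wrapping in empty sprinklers changes neither binders nor free variables.\<close>
  have legal0: "legal ar (fill \<Xi> {#imp {#} \<Phi>'#})"
    using legal arity_fill(1)[of ar \<Xi> \<Phi>']
    by (intro legal_fill_mono[OF legal]) (auto simp: imp_def legal_def)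
  have legal1: "legal ar (fill \<Xi> {#imp \<Psi>' \<Phi>'#})"
  proof -
    have binders: "binders (fill \<Xi> {#imp \<Psi>' \<Phi>'#}) = binders ?A + binders \<Psi>'"
      by (simp add: binders_fill(1)[of \<Xi> \<Phi>'] binders_fill(1)[of \<Xi> "{#_#}"] imp_def)
    then have bv: "bv (fill \<Xi> {#imp \<Psi>' \<Phi>'#}) = bv ?A \<union> bv \<Psi>'"
      by (simp add: bv_eq_binders)
    have "count (binders ?A + binders \<Psi>') x \<le> 1" for x
    proof -
      have "count (binders ?A) x = 0 \<or> count (binders \<Psi>') x = 0"
        using \<Psi>'(2) by (auto simp: bv_eq_binders count_eq_zero_iff)
      then show ?thesis
        using legal \<Psi>'(3)[of x] by (auto simp: legal_def)
    qed
    \<comment> \<open>Pollinability enters here: a free variable of \<Psi>' is either captured by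
      \<Xi> or already free in the whole, so none can clash with a binder.\<close>
    moreover have "fv (fill \<Xi> {#imp \<Psi>' \<Phi>'#}) \<subseteq> fv ?A"
      using fv_pollinable[OF poll'] fv_fill(1)[of \<Xi> \<Phi>'] fv_fill(1)[of \<Xi> "{#imp \<Psi>' \<Phi>'#}"]
      by (auto simp: imp_def)
    moreover have "arity_bouquet ar (fill \<Xi> {#imp \<Psi>' \<Phi>'#})"
      using legal assms(2) arity_alpha[OF \<Psi>'(1)] arity_fill(1)[of ar \<Xi> \<Phi>']
        arity_fill(1)[of ar \<Xi> "{#imp \<Psi>' \<Phi>'#}"]
      by (auto simp: imp_def legal_def)
    ultimately show ?thesis
      using legal \<Psi>'(2) unfolding legal_def binders bv by blast
  qed
  have "nat_rule \<Phi>' {#imp {#} \<Phi>'#}"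
    unfolding imp_def by (rule epis)
  then have "nat_step ar ?A (fill \<Xi> {#imp {#} \<Phi>'#})"
    using legal legal0 by (rule nat_rule_imp_nat_step)
  moreover have "nat_step ar (fill \<Xi> {#imp {#} \<Phi>'#}) (fill \<Xi> {#imp \<Psi>' \<Phi>'#})"
  proof -
    \<comment> \<open>The hole is now the empty pistil left by epis. Since \<open>poll_up\<close>
      acts on this whole context, the surrounding context of the step is the trivial one.\<close>
    let ?\<Xi> = "ctx_comp \<Xi> (Ctx {#} (InPistil {||} (Ctx {#} Hole) {#Garden {||} \<Phi>'#}))"
    have "nat_rule (fill ?\<Xi> {#}) (fill ?\<Xi> \<Psi>')"
      using poll' by (intro poll_up pollinable_ctx_comp)
    then show ?thesis
      using legal0 legal1 nat_rule_imp_nat_step[where \<Xi> = "Ctx {#} Hole"]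
      by (simp add: fill_ctx_comp imp_def)
  qed
  \<comment> \<open>The empty bouquet is pollinable in every context, so provability applies in
    \<Xi> to this representative of the implication.\<close>
  moreover have "(nat_step ar)\<^sup>*\<^sup>* (fill \<Xi> {#imp \<Psi>' \<Phi>'#}) (fill \<Xi> {#})"
    using assms(3) legal1 alpha_imp[OF \<Psi>'(1) \<open>alpha \<Phi> \<Phi>'\<close>]
    unfolding provable_def hyp_provable_def by (simp add: pollinable_def)
  ultimately show "(nat_step ar)\<^sup>*\<^sup>* ?A (fill \<Xi> {#})"
    by (meson converse_rtranclp_into_rtranclp)
qed

theorem mainTheorem2:
  fixes ar :: "'p::countable \<Rightarrow> nat"
    and \<Psi> \<Phi> :: "('p, 'v::countable) bouquet"
  assumes "infinite (UNIV :: 'v set)"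
    and "legal ar \<Psi>" and "legal ar \<Phi>"
  shows "hyp_provable ar \<Psi> \<Phi> \<longleftrightarrow> provable ar {#imp \<Psi> \<Phi>#}"
  using assms(1,2) hyp_provable_if_provable_imp provable_imp_if_hyp_provable by metis

end
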